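(* For a finite S-semigroup $S$, the order of a subgroup of $S$ need not divide the order of $S$; that is, there exist a finite S-semigroup $S$ and a subgroup $A$ of $S$ such that $|A|$ does not divide $|S|$.
   Context: An S-semigroup (Smarandache semigroup) is a semigroup $S$ having a proper subset $A \subsetneq S$ that is a group with respect to the operation of $S$ (its identity need not be an identity of $S$). Following the paper's usage, a one-element group is not counted. A "subgroup of $S$" means such a proper subset (with at least two elements). *)

theory Defs
  imports "HOL-Algebra.Group"
begin

text \<open>
  A semigroup is given by an explicit carrier set and an operation. The record type
  of \<^theory>\<open>HOL-Algebra.Group\<close> is not used for it because a semigroup has no
  distinguished unit.
\<close>

definition semigroup_on :: "'a set \<Rightarrow> ('a \<Rightarrow> 'a \<Rightarrow> 'a) \<Rightarrow> bool" where
  "semigroup_on S f \<longleftrightarrow>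
     (\<forall>x\<in>S. \<forall>y\<in>S. f x y \<in> S) \<and>
     (\<forall>x\<in>S. \<forall>y\<in>S. \<forall>z\<in>S. f (f x y) z = f x (f y z))"

text \<open>
  The identity \<open>e\<close> of the group \<open>A\<close> belongs to \<open>A\<close>, but it need not be
  an identity of \<open>S\<close>. One-element groups are not counted as subgroups.
\<close>

definition subgroup_of_semigroup :: "'a set \<Rightarrow> 'a set \<Rightarrow> ('a \<Rightarrow> 'a \<Rightarrow> 'a) \<Rightarrow> bool" where
  "subgroup_of_semigroup A S f \<longleftrightarrow>
     A \<subset> S \<and> (\<exists>x\<in>A. \<exists>y\<in>A. x \<noteq> y) \<and>
     (\<exists>e. group \<lparr>carrier = A, mult = f, one = e\<rparr>)"

definition S_semigroup :: "'a set \<Rightarrow> ('a \<Rightarrow> 'a \<Rightarrow> 'a) \<Rightarrow> bool" where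
  "S_semigroup S f \<longleftrightarrow> semigroup_on S f \<and> (\<exists>A. subgroup_of_semigroup A S f)"

end

theory Submission
  imports Defs
begin

text \<open>
  Take the integers modulo 3 under multiplication. The units 1 and 2 form a proper
  subset that is a group of order 2, and 2 does not divide 3. Lagrange's argument
  breaks down because 0 is not invertible: the translate of the group of units
  by 0 collapses to a single point, so the translates of the subgroup no longer
  have equal size.
\<close>

lemma semigroup_on_mult_mod_3: "semigroup_on {0, 1, 2::nat} (\<lambda>x y. x * y mod 3)"
  by (simp add: semigroup_on_def)

lemma group_units_mod_3: "group \<lparr>carrier = {1, 2::nat}, mult = \<lambda>x y. x * y mod 3, one = 1\<rparr>"
  by (rule groupI) auto

theorem theorem5p1p4:
  shows "\<exists>(S :: nat set) f. finite S \<and> S_semigroup S f \<and>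
    (\<exists>A. subgroup_of_semigroup A S f \<and> \<not> card A dvd card S)"
proof -
  let ?S = "{0, 1, 2::nat}" and ?A = "{1, 2::nat}" and ?f = "\<lambda>x y::nat. x * y mod 3"
  have sub: "subgroup_of_semigroup ?A ?S ?f"
    unfolding subgroup_of_semigroup_def using group_units_mod_3
    by (auto simp: psubset_insert_iff)
  moreover have "S_semigroup ?S ?f"
    unfolding S_semigroup_def using semigroup_on_mult_mod_3 sub by blast
  moreover have "\<not> card ?A dvd card ?S"
    by (simp flip: numeral_2_eq_2)
  moreover have "finite ?S"
    by simp
  ultimately show ?thesis
    by blast
qed

end
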